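(* Let $\Theta>1$ and let $\sigma$ be an instance of open, non-preemptive online Dial-a-Ride on the line. If $\textsc{Smartstart}_\Theta$ does not wait before executing its final schedule $S_N$, then $$\frac{\textsc{Smartstart}(\sigma)}{\textsc{Opt}(\sigma)}\le f_2(\Theta):=\Theta+1-\frac{\Theta-1}{3\Theta+3}.$$
   Context: Open, non-preemptive Dial-a-Ride on the real line. An instance is a finite nonempty set of requests $\sigma=\{\sigma_1,\dots,\sigma_n\}$ with $\sigma_i=(a_i,b_i;r_i)$, $a_i,b_i\in\mathbb{R}$, $r_i\ge 0$: request $\sigma_i$ appears at time $r_i$ at position $a_i$ and must be transported to position $b_i$. A single server of capacity $c\in\mathbb{N}\cup\{\infty\}$ (arbitrary but fixed) starts at the origin at time $0$, moves with unit speed (it may also wait), cannot pick up a request before its release time, never carries more than $c$ requests at once, and a request that was picked up stays on board until it is delivered at its destination (non-preemptive). In the open version the server need not return to the origin. The length of a schedule is the time from its start until its last request is delivered (waiting included). $L(t,p,R)$ is the length of a shortest schedule that starts at position $p$ at time $t$ and serves all requests in $R\subseteq\sigma$ respecting release times. The offline optimum is $\textsc{Opt}(\sigma):=L(0,0,\sigma)$. In the online problem, $\sigma_i$ is revealed only at time $r_i$, and the number of requests is not known in advance. Algorithm $\textsc{Smartstart}_\Theta$ (parameter $\Theta>1$): let $R_t$ be the set of requests with release time at most $t$ that have not been served by time $t$. Starting at position $p_1=0$ at time $0$, for $j=1,2,\dots$: whenever the server is idle at position $p_j$ at current time $t$, it waits until there are unserved released requests and then until the earliest time $t_j:=\min\{t'\ge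 t: R_{t'}\ne\emptyset,\ t'\ge L(t',p_j,R_{t'})/(\Theta-1)\}$. At time $t_j$ it starts a shortest schedule $S_j$ serving $\sigma_{S_j}:=R_{t_j}$ from $p_j$, and executes it while ignoring all newly appearing requests; it ends at position $p_{j+1}$, the position where the last request of $S_j$ is delivered. $N$ denotes the number of schedules needed to serve $\sigma$, and $\textsc{Smartstart}(\sigma)=t_N+L(t_N,p_N,\sigma_{S_N})$ is the time at which all requests have been served. $\textsc{Smartstart}$ does not wait before executing $S_N$ if $t_N$ equals the finishing time $t_{N-1}+L(t_{N-1},p_{N-1},\sigma_{S_{N-1}})$ of $S_{N-1}$ (which is read as time $0$ if $N=1$). The inequality $A/B\le\rho$ is understood as $A\le\rho B$. *)

theory Defs
  imports "HOL-Analysis.Lipschitz" "HOL-Library.Extended_Nat"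
begin

text \<open>
  An instance is a finite sequence of requests, and a request is referred to by its index.
  So two different requests may have the same start, destination and release time.
\<close>

record request =
  src :: real
  dst :: real
  rel :: real

type_synonym inst = "request list"

definition valid_instance :: "inst \<Rightarrow> bool" where
  "valid_instance \<sigma> \<longleftrightarrow> \<sigma> \<noteq> [] \<and> (\<forall>i<length \<sigma>. rel (\<sigma> ! i) \<ge> 0)"

datatype action = Pickup nat | Deliver nat

fun place :: "inst \<Rightarrow> action \<Rightarrow> real" where
  "place \<sigma> (Pickup i) = src (\<sigma> ! i)"
| "place \<sigma> (Deliver i) = dst (\<sigma> ! i)"

text \<open>
  A schedule is the trajectory of the server together with the timed list of its actions in the
  order of execution.  The order matters for actions that happen at the same time: a server that
  is full has to deliver a request before it can pick up another one, even one whose start and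
  destination coincide.
\<close>

record schedule =
  pos :: "real \<Rightarrow> real"
  acts :: "(real \<times> action) list"

definition on_board :: "(real \<times> action) list \<Rightarrow> nat set" where
  "on_board es = {i. Pickup i \<in> snd ` set es \<and> Deliver i \<notin> snd ` set es}"

text \<open>
  \<open>is_schedule c \<sigma> t p R S\<close>: the server of capacity \<open>c\<close> starts empty at position \<open>p\<close> at time \<open>t\<close>
  and \<open>S\<close> serves exactly the requests in \<open>R\<close>.  Moving with unit speed and waiting is expressed by
  a trajectory of speed at most one (moving slower amounts to moving with unit speed and waiting).
  Every request is picked up once and delivered once, so there is no preemption.
\<close>

definition is_schedule :: "enat \<Rightarrow> inst \<Rightarrow> real \<Rightarrow> real \<Rightarrow> nat set \<Rightarrow> schedule \<Rightarrow> bool" where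
  "is_schedule c \<sigma> t p R S \<longleftrightarrow>
     1-lipschitz_on {t..} (pos S) \<and> pos S t = p \<and>
     sorted (map fst (acts S)) \<and>
     (\<forall>(s, x) \<in> set (acts S). t \<le> s \<and> pos S s = place \<sigma> x) \<and>
     (\<forall>s i. (s, Pickup i) \<in> set (acts S) \<longrightarrow> rel (\<sigma> ! i) \<le> s) \<and>
     distinct (map snd (acts S)) \<and>
     snd ` set (acts S) = Pickup ` R \<union> Deliver ` R \<and>
     (\<forall>i\<in>R. \<exists>j k. j < k \<and> k < length (acts S) \<and>
        snd (acts S ! j) = Pickup i \<and> snd (acts S ! k) = Deliver i) \<and>
     (\<forall>k\<le>length (acts S). enat (card (on_board (take k (acts S)))) \<le> c)"

text \<open>The last action of a nonempty schedule is always a delivery.\<close>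

definition sched_length :: "real \<Rightarrow> schedule \<Rightarrow> real" where
  "sched_length t S = (if acts S = [] then 0 else fst (last (acts S)) - t)"

definition end_pos :: "inst \<Rightarrow> schedule \<Rightarrow> real" where
  "end_pos \<sigma> S = place \<sigma> (snd (last (acts S)))"

text \<open>
  The infimum is a minimum: there are finitely many orders of the actions, and for each of them
  executing every action as early as possible is optimal.
\<close>

definition L :: "enat \<Rightarrow> inst \<Rightarrow> real \<Rightarrow> real \<Rightarrow> nat set \<Rightarrow> real" where
  "L c \<sigma> t p R = (INF S \<in> {S. is_schedule c \<sigma> t p R S}. sched_length t S)"

definition is_shortest :: "enat \<Rightarrow> inst \<Rightarrow> real \<Rightarrow> real \<Rightarrow> nat set \<Rightarrow> schedule \<Rightarrow> bool" where
  "is_shortest c \<sigma> t p R S \<longleftrightarrow> is_schedule c \<sigma> t p R S \<and>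
     (\<forall>S'. is_schedule c \<sigma> t p R S' \<longrightarrow> sched_length t S \<le> sched_length t S')"

definition Opt :: "enat \<Rightarrow> inst \<Rightarrow> real" where
  "Opt c \<sigma> = L c \<sigma> 0 0 {..<length \<sigma>}"

text \<open>
  In the following, \<open>S j\<close>, \<open>t j\<close> and \<open>p j\<close> are the \<open>j\<close>-th schedule of the algorithm, its starting
  time and its starting position, where \<open>j\<close> counts from 1.  \<open>unserved \<sigma> S j s\<close> is the set of
  requests released by time \<open>s\<close> and not delivered by time \<open>s\<close> in one of the schedules before the
  \<open>j\<close>-th one; it is the set \<open>R\<^sub>s\<close> as long as the \<open>j\<close>-th schedule has not been started.
\<close>

definition unserved :: "inst \<Rightarrow> (nat \<Rightarrow> schedule) \<Rightarrow> nat \<Rightarrow> real \<Rightarrow> nat set" where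
  "unserved \<sigma> S j s = {i. i < length \<sigma> \<and> rel (\<sigma> ! i) \<le> s \<and>
     \<not> (\<exists>k\<in>{1..<j}. \<exists>s'\<le>s. (s', Deliver i) \<in> set (acts (S k)))}"

definition start_times ::
  "enat \<Rightarrow> real \<Rightarrow> inst \<Rightarrow> (nat \<Rightarrow> schedule) \<Rightarrow> nat \<Rightarrow> real \<Rightarrow> real \<Rightarrow> real set" where
  "start_times c \<Theta> \<sigma> S j s q = {s'. s \<le> s' \<and> unserved \<sigma> S j s' \<noteq> {} \<and>
     L c \<sigma> s' q (unserved \<sigma> S j s') / (\<Theta> - 1) \<le> s'}"

definition finish_time ::
  "enat \<Rightarrow> inst \<Rightarrow> (nat \<Rightarrow> real) \<Rightarrow> (nat \<Rightarrow> real) \<Rightarrow> (nat \<Rightarrow> schedule) \<Rightarrow> nat \<Rightarrow> real" where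
  "finish_time c \<sigma> t p S j =
     (if j = 0 then 0 else t j + L c \<sigma> (t j) (p j) (unserved \<sigma> S j (t j)))"

text \<open>
  The algorithm may choose any shortest schedule in each step, so it is described by the set of its
  possible complete runs, consisting of \<open>N\<close> schedules after which all requests are served.
\<close>

definition smartstart_run ::
  "enat \<Rightarrow> real \<Rightarrow> inst \<Rightarrow> nat \<Rightarrow> (nat \<Rightarrow> real) \<Rightarrow> (nat \<Rightarrow> real) \<Rightarrow> (nat \<Rightarrow> schedule) \<Rightarrow> bool" where
  "smartstart_run c \<Theta> \<sigma> N t p S \<longleftrightarrow>
     p 1 = 0 \<and>
     (\<forall>j\<in>{1..N}.
        t j \<in> start_times c \<Theta> \<sigma> S j (finish_time c \<sigma> t p S (j - 1)) (p j) \<and>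
        (\<forall>s \<in> start_times c \<Theta> \<sigma> S j (finish_time c \<sigma> t p S (j - 1)) (p j). t j \<le> s) \<and>
        is_shortest c \<sigma> (t j) (p j) (unserved \<sigma> S j (t j)) (S j) \<and>
        p (j + 1) = end_pos \<sigma> (S j)) \<and>
     (\<Union>j\<in>{1..N}. unserved \<sigma> S j (t j)) = {..<length \<sigma>}"

definition f2 :: "real \<Rightarrow> real" where
  "f2 \<Theta> = \<Theta> + 1 - (\<Theta> - 1) / (3 * \<Theta> + 3)"

end

(*
  Let Q be any offline schedule, of length T. Let tau be the time at which Q executes its first
  action for a request of the final schedule S_N, say at position a. All these requests are
  released after t_{N-1}, so t_{N-1} < tau, and walking from p_N to a and replaying the rest of Q
  shows that the length of S_N is at most |a - p_N| + T - tau.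

  If Q visits p_N after time tau, then |a - p_N| <= T - tau and the claim is easy. Otherwise Q
  visits p_N by time g := tau - |a - p_N|, and t_{N-2} <= g since the requests of S_{N-1} are
  released after t_{N-2}; hence |p_{N-1}| <= Theta g. Let q be the place where Q executes its last
  action for a request of S_{N-1}. Replaying Q from the origin bounds the length D of S_{N-1} from
  above in terms of q. On the other hand S_{N-1} visits q on its way from p_{N-1} to p_N, so
  D >= |q - p_{N-1}| + |q - p_N|. Together these bound D by a multiple of g, up to T - tau, and this
  is balanced against the bound D <= (Theta - 1) t_{N-1} of the starting rule.
*)

theory Submission
  imports Defs
begin

subsection \<open>Lists of actions\<close>

fun req :: "action \<Rightarrow> nat" where
  "req (Pickup i) = i"
| "req (Deliver i) = i"

lemma actions_eq: "Pickup ` R \<union> Deliver ` R = {x. req x \<in> R}"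
proof -
  have "x \<in> Pickup ` R \<union> Deliver ` R \<longleftrightarrow> req x \<in> R" for x
    by (cases x) auto
  then show ?thesis by auto
qed

text \<open>The right-hand form survives filtering directly, whereas indices would shift. The order
  of pickup and delivery is therefore carried through the replay as a decomposition.\<close>

lemma nth_before_iff_append:
  "(\<exists>j k. j < k \<and> k < length l \<and> l ! j = x \<and> l ! k = y) \<longleftrightarrow>
   (\<exists>xs ys zs. l = xs @ x # ys @ y # zs)" (is "?L \<longleftrightarrow> ?R")
proof
  assume ?L
  then obtain j k where jk: "j < k" "k < length l" "l ! j = x" "l ! k = y" by blast
  have 1: "l = take k l @ y # drop (Suc k) l"
    using jk id_take_nth_drop by blast
  have 2: "take k l = take j (take k l) @ x # drop (Suc j) (take k l)"
    using jk id_take_nth_drop[of j "take k l"] by simp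
  have "l = take j (take k l) @ x # drop (Suc j) (take k l) @ y # drop (Suc k) l"
    using 1 2 by (metis append.assoc append_Cons)
  then show ?R by blast
next
  assume ?R
  then obtain xs ys zs where l: "l = xs @ x # ys @ y # zs" by blast
  have "l ! length xs = x" "l ! (length xs + Suc (length ys)) = y"
    by (simp_all add: l nth_append)
  moreover have "length xs + Suc (length ys) < length l" by (simp add: l)
  ultimately show ?L
    by (intro exI[of _ "length xs"] exI[of _ "length xs + Suc (length ys)"]) auto
qed

lemma snd_nth_before_iff:
  "(\<exists>j k. j < k \<and> k < length l \<and> snd (l ! j) = x \<and> snd (l ! k) = y) \<longleftrightarrow>
   (\<exists>xs ys zs. map snd l = xs @ x # ys @ y # zs)"
proof -
  have "(\<exists>j k. j < k \<and> k < length l \<and> snd (l ! j) = x \<and> snd (l ! k) = y) \<longleftrightarrow>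
    (\<exists>j k. j < k \<and> k < length (map snd l) \<and> map snd l ! j = x \<and> map snd l ! k = y)"
    by (intro ex_cong1 iffI; auto)
  then show ?thesis unfolding nth_before_iff_append .
qed

text \<open>Skipping actions only merges neighbouring prefixes. So every intermediate load of a
  filtered schedule is the restriction of an intermediate load of the original one, which transfers
  the capacity bound.\<close>

lemma take_filter: "\<exists>k'\<le>length xs. take k (filter P xs) = filter P (take k' xs)"
proof (induction xs arbitrary: k)
  case Nil
  then show ?case by simp
next
  case (Cons x xs)
  show ?case
  proof (cases "P x")
    case True
    show ?thesis
    proof (cases k)
      case 0
      then show ?thesis by (intro exI[of _ 0]) simp
    next
      case (Suc m)
      obtain k' where "k' \<le> length xs" "take m (filter P xs) = filter P (take k' xs)"
        using Cons by blast
      then show ?thesis using True Suc by (intro exI[of _ "Suc k'"]) simp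
    qed
  next
    case False
    obtain k' where "k' \<le> length xs" "take k (filter P xs) = filter P (take k' xs)"
      using Cons by blast
    then show ?thesis using False by (intro exI[of _ "Suc k'"]) simp
  qed
qed

lemma finite_on_board: "finite (on_board es)"
proof -
  have "on_board es \<subseteq> req ` snd ` set es"
  proof
    fix i assume "i \<in> on_board es"
    then have "Pickup i \<in> snd ` set es" by (simp add: on_board_def)
    then have "req (Pickup i) \<in> req ` snd ` set es" by (rule imageI)
    then show "i \<in> req ` snd ` set es" by simp
  qed
  then show ?thesis by (rule finite_subset) auto
qed

lemma on_board_cong: "map snd es = map snd es' \<Longrightarrow> on_board es = on_board es'"
  unfolding on_board_def by (metis set_map)

lemma on_board_filter:
  "on_board (filter (\<lambda>z. req (snd z) \<in> R) es) = on_board es \<inter> R"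
proof -
  have "snd ` set (filter (\<lambda>z. req (snd z) \<in> R) es) = snd ` set es \<inter> {x. req x \<in> R}"
    by auto
  then show ?thesis unfolding on_board_def by auto
qed

lemma sorted_shift:
  fixes d :: real
  assumes "sorted (map fst es)"
  shows "sorted (map fst (map (\<lambda>(s, x). (s + d, x)) es))"
  using assms by (induction es) (auto simp: case_prod_beta)

subsection \<open>Schedules\<close>

context
  fixes c \<sigma> t p R S
  assumes S: "is_schedule c \<sigma> t p R S"
begin

lemma schedule_start: "pos S t = p"
  using S unfolding is_schedule_def by auto

lemma schedule_actions: "snd ` set (acts S) = {x. req x \<in> R}"
  using S unfolding is_schedule_def actions_eq by auto

lemma schedule_action:
  assumes "(s, x) \<in> set (acts S)"
  shows "t \<le> s" "pos S s = place \<sigma> x" "req x \<in> R"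
proof -
  have "x \<in> snd ` set (acts S)" using assms by force
  then show "req x \<in> R" using schedule_actions by auto
  have "\<forall>(s, x) \<in> set (acts S). t \<le> s \<and> pos S s = place \<sigma> x"
    using S unfolding is_schedule_def by blast
  then show "t \<le> s" "pos S s = place \<sigma> x" using assms by auto
qed

lemma schedule_time:
  assumes "req x \<in> R"
  obtains s where "(s, x) \<in> set (acts S)"
proof -
  have "x \<in> snd ` set (acts S)" using schedule_actions assms by auto
  then show thesis using that by force
qed

lemma schedule_speed:
  assumes "t \<le> s" "t \<le> s'"
  shows "\<bar>pos S s - pos S s'\<bar> \<le> \<bar>s - s'\<bar>"
proof -
  have "1-lipschitz_on {t..} (pos S)" using S unfolding is_schedule_def by auto
  from lipschitz_onD[OF this, of s s'] assms show ?thesis by (simp add: dist_real_def)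
qed

lemma schedule_nonempty: "acts S = [] \<longleftrightarrow> R = {}"
proof
  assume "acts S = []"
  then have "{x. req x \<in> R} = {}" using schedule_actions by simp
  then have "req (Pickup i) \<notin> R" for i by blast
  then show "R = {}" by auto
next
  assume "R = {}"
  then show "acts S = []" using schedule_actions by simp
qed

lemma schedule_le_length:
  assumes "(s, x) \<in> set (acts S)"
  shows "s \<le> t + sched_length t S"
proof -
  have ne: "acts S \<noteq> []" using assms by auto
  have so: "sorted (map fst (acts S))" using S unfolding is_schedule_def by auto
  obtain k where k: "k < length (acts S)" "acts S ! k = (s, x)"
    using assms by (meson in_set_conv_nth)
  have "map fst (acts S) ! k \<le> map fst (acts S) ! (length (acts S) - 1)"
    using so k by (intro sorted_nth_mono) auto
  then have "s \<le> fst (last (acts S))" using k ne by (simp add: last_conv_nth)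
  then show ?thesis using ne by (simp add: sched_length_def)
qed

lemma schedule_length_nonneg: "0 \<le> sched_length t S"
proof (cases "acts S = []")
  case True
  then show ?thesis by (simp add: sched_length_def)
next
  case False
  then have "(fst (last (acts S)), snd (last (acts S))) \<in> set (acts S)" by simp
  then have "t \<le> fst (last (acts S))" by (rule schedule_action)
  then show ?thesis using False by (simp add: sched_length_def)
qed

lemma schedule_last:
  assumes "R \<noteq> {}"
  obtains x where "(t + sched_length t S, x) \<in> set (acts S)" "end_pos \<sigma> S = place \<sigma> x"
proof -
  have ne: "acts S \<noteq> []" using assms schedule_nonempty by simp
  then have "last (acts S) \<in> set (acts S)" by simp
  then show thesis
    using that[of "snd (last (acts S))"] ne by (simp add: sched_length_def end_pos_def)
qed

text \<open>Release times are imposed on pickups only. A delivery comes after the pickup of the same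
  request in the list: distinctness identifies its index, and sortedness turns the order of indices
  into an order of times.\<close>

lemma schedule_after_release:
  assumes "(s, x) \<in> set (acts S)"
  shows "rel (\<sigma> ! req x) \<le> s"
proof (cases x)
  case (Pickup i)
  then show ?thesis using S assms unfolding is_schedule_def by auto
next
  case (Deliver i)
  have so: "sorted (map fst (acts S))" and di: "distinct (map snd (acts S))"
    using S unfolding is_schedule_def by auto
  have "i \<in> R" using schedule_action(3)[OF assms] Deliver by simp
  then obtain j k where jk: "j < k" "k < length (acts S)" "snd (acts S ! j) = Pickup i"
    "snd (acts S ! k) = Deliver i"
    using S unfolding is_schedule_def by blast
  obtain m where m: "m < length (acts S)" "acts S ! m = (s, x)"
    using assms by (meson in_set_conv_nth)
  have "map snd (acts S) ! m = map snd (acts S) ! k" using m jk Deliver by simp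
  then have "m = k" using di m(1) jk(2) by (metis length_map nth_eq_iff_index_eq)
  have "map fst (acts S) ! j \<le> map fst (acts S) ! k"
    using so jk by (intro sorted_nth_mono) auto
  then have "fst (acts S ! j) \<le> s" using jk m \<open>m = k\<close> by simp
  moreover have "(fst (acts S ! j), Pickup i) \<in> set (acts S)"
    using jk by (metis nth_mem order.strict_trans prod.collapse)
  then have "rel (\<sigma> ! i) \<le> fst (acts S ! j)" using S unfolding is_schedule_def by blast
  ultimately show ?thesis using Deliver by simp
qed

lemma schedule_first_action:
  assumes "Q \<subseteq> R" "Q \<noteq> {}"
  obtains s x where "(s, x) \<in> set (acts S)" "req x \<in> Q"
    "\<And>s' x'. (s', x') \<in> set (acts S) \<Longrightarrow> req x' \<in> Q \<Longrightarrow> s \<le> s'"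
proof -
  let ?E = "{z \<in> set (acts S). req (snd z) \<in> Q}"
  obtain i where "i \<in> Q" using assms by auto
  then obtain s0 where "(s0, Pickup i) \<in> set (acts S)"
    using schedule_time[of "Pickup i"] assms by auto
  then have ne: "?E \<noteq> {}" using \<open>i \<in> Q\<close> by force
  have fin: "finite ?E" by simp
  obtain z where z: "z \<in> ?E" "\<And>z'. z' \<in> ?E \<Longrightarrow> fst z \<le> fst z'"
    using that arg_min_if_finite(1)[OF fin ne, of fst] arg_min_least[OF fin ne, of _ fst] by blast
  show thesis
  proof (rule that[of "fst z" "snd z"])
    show "fst z \<le> s'" if "(s', x') \<in> set (acts S)" "req x' \<in> Q" for s' x'
      using z(2)[of "(s', x')"] that by simp
  qed (use z in auto)
qed

lemma schedule_last_action:
  assumes "Q \<subseteq> R" "Q \<noteq> {}"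
  obtains s x where "(s, x) \<in> set (acts S)" "req x \<in> Q"
    "\<And>s' x'. (s', x') \<in> set (acts S) \<Longrightarrow> req x' \<in> Q \<Longrightarrow> s' \<le> s"
proof -
  let ?E = "{z \<in> set (acts S). req (snd z) \<in> Q}"
  obtain i where "i \<in> Q" using assms by auto
  then obtain s0 where "(s0, Pickup i) \<in> set (acts S)"
    using schedule_time[of "Pickup i"] assms by auto
  then have ne: "?E \<noteq> {}" using \<open>i \<in> Q\<close> by force
  have fin: "finite ?E" by simp
  obtain z where z: "z \<in> ?E" "\<And>z'. z' \<in> ?E \<Longrightarrow> - fst z \<le> - fst z'"
    using that arg_min_if_finite(1)[OF fin ne, of "\<lambda>z. - fst z"]
      arg_min_least[OF fin ne, of _ "\<lambda>z. - fst z"] by blast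
  show thesis
  proof (rule that[of "fst z" "snd z"])
    show "s' \<le> fst z" if "(s', x') \<in> set (acts S)" "req x' \<in> Q" for s' x'
      using z(2)[of "(s', x')"] that by simp
  qed (use z in auto)
qed

lemma L_le_sched_length: "L c \<sigma> t p R \<le> sched_length t S"
proof -
  \<comment> \<open>An infimum of reals is a lower bound only for sets bounded below.\<close>
  have "bdd_below (sched_length t ` {S'. is_schedule c \<sigma> t p R S'})"
  proof (rule bdd_belowI2)
    fix S' assume "S' \<in> {S'. is_schedule c \<sigma> t p R S'}"
    then show "0 \<le> sched_length t S'"
      unfolding sched_length_def is_schedule_def
      by (auto simp: case_prod_beta dest!: last_in_set)
  qed
  then show ?thesis unfolding L_def by (rule cINF_lower) (use S in simp)
qed

end

text \<open>A schedule chosen in a run attains the infimum, so \<open>L\<close> can be read off a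
  concrete trajectory.\<close>

lemma L_eq_sched_length:
  assumes "is_shortest c \<sigma> t p R S"
  shows "L c \<sigma> t p R = sched_length t S"
proof (rule antisym)
  show "L c \<sigma> t p R \<le> sched_length t S"
    using assms by (intro L_le_sched_length) (simp add: is_shortest_def)
  show "sched_length t S \<le> L c \<sigma> t p R"
    unfolding L_def by (rule cINF_greatest) (use assms in \<open>auto simp: is_shortest_def\<close>)
qed

text \<open>The server walks from \<open>p\<close> to \<open>pos S \<tau>\<close> and then replays the part of \<open>S\<close> from \<open>\<tau>\<close> on,
  skipping every request outside \<open>R\<close>.\<close>

lemma L_le_replay:
  fixes t p \<tau> z :: real
  assumes S: "is_schedule c \<sigma> t0 p0 Q S" and "R \<subseteq> Q" "R \<noteq> {}" "t0 \<le> \<tau>"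
    and released: "\<And>i. i \<in> R \<Longrightarrow> rel (\<sigma> ! i) \<le> t"
    and window: "\<And>s x. (s, x) \<in> set (acts S) \<Longrightarrow> req x \<in> R \<Longrightarrow> \<tau> \<le> s \<and> s \<le> z"
  shows "L c \<sigma> t p R \<le> \<bar>p - pos S \<tau>\<bar> + (z - \<tau>)"
proof -
  define a where "a = pos S \<tau>"
  define m where "m = t + \<bar>p - a\<bar>"
  \<comment> \<open>The server is at \<open>a\<close> at time \<open>m\<close>, where the old time
    \<open>\<tau>\<close> becomes \<open>m\<close>. The shift \<open>d\<close> may be negative;
    releases are still respected, since \<open>R\<close> is released by \<open>t\<close> and no
    replayed action happens before \<open>m\<close>, hence none before \<open>t\<close>.\<close>
  define d where "d = m - \<tau>"
  define P where "P = (\<lambda>z :: real \<times> action. req (snd z) \<in> R)"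
  define A where "A = map (\<lambda>(s, x). (s + d, x)) (filter P (acts S))"
  define S' where "S' = \<lparr>pos = (\<lambda>s. if s \<le> m then p + sgn (a - p) * (s - t) else pos S (s - d)),
    acts = A\<rparr>"
  have lipS: "1-lipschitz_on {t0..} (pos S)" and sorted: "sorted (map fst (acts S))"
    and dist: "distinct (map snd (acts S))"
    and cap: "\<And>k. k \<le> length (acts S) \<Longrightarrow> enat (card (on_board (take k (acts S)))) \<le> c"
    and order: "\<And>i. i \<in> Q \<Longrightarrow>
      \<exists>xs ys zs. map snd (acts S) = xs @ Pickup i # ys @ Deliver i # zs"
    using S unfolding is_schedule_def snd_nth_before_iff by auto
  have tm: "t \<le> m" by (simp add: m_def)
  have meet: "p + sgn (a - p) * (m - t) = a"
    by (auto simp: m_def sgn_if)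
  have m_pos: "pos S (m - d) = a" by (simp add: d_def a_def)
  have inA: "(s, x) \<in> set A \<longleftrightarrow> (s - d, x) \<in> set (acts S) \<and> req x \<in> R" for s x
    unfolding A_def P_def by (force simp: image_iff)
  have time: "m \<le> s \<and> s \<le> z + d" if "(s, x) \<in> set A" for s x
    using window[of "s - d" x] that unfolding inA by (auto simp: d_def)
  have pos_ge: "pos S' s = pos S (s - d)" if "m \<le> s" for s
    using that meet m_pos by (cases "s = m") (auto simp: S'_def)
  have sndA: "map snd A = filter (\<lambda>x. req x \<in> R) (map snd (acts S))"
    unfolding A_def P_def by (simp add: filter_map comp_def case_prod_beta)
  have schedule: "is_schedule c \<sigma> t p R S'"
    unfolding is_schedule_def snd_nth_before_iff actions_eq
  proof (intro conjI ballI allI impI)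
    have l1: "1-lipschitz_on {t..m} (\<lambda>s. p + sgn (a - p) * (s - t))"
      by (rule lipschitz_onI) (auto simp: dist_real_def sgn_if)
    have l2: "1-lipschitz_on {m..s} (\<lambda>s. pos S (s - d))" for s
    proof (rule lipschitz_onI)
      fix x y assume "x \<in> {m..s}" "y \<in> {m..s}"
      then show "dist (pos S (x - d)) (pos S (y - d)) \<le> 1 * dist x y"
        using lipschitz_onD[OF lipS, of "x - d" "y - d"] \<open>t0 \<le> \<tau>\<close>
        by (auto simp: d_def dist_real_def)
    qed simp
    \<comment> \<open>Walk and replay agree at \<open>m\<close>, so they can be glued on compact
      intervals. Any two points of the half-line lie in one such interval.\<close>
    have l3: "1-lipschitz_on {t..s} (pos S')" for s
      using lipschitz_on_concat[OF l1 l2[of s]] meet m_pos by (simp add: S'_def)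
    show "1-lipschitz_on {t..} (pos S')"
    proof (rule lipschitz_onI)
      fix x y assume "x \<in> {t..}" "y \<in> {t..}"
      then show "dist (pos S' x) (pos S' y) \<le> 1 * dist x y"
        using lipschitz_onD[OF l3[of "max x y"], of x y] by auto
    qed simp
    show "pos S' t = p" using tm by (simp add: S'_def)
    show "sorted (map fst (acts S'))"
      using sorted_shift[OF sorted_filter[OF sorted, of P], of d] by (simp add: S'_def A_def)
    show "distinct (map snd (acts S'))" using dist sndA by (simp add: S'_def)
    show "snd ` set (acts S') = {x. req x \<in> R}"
    proof -
      have "set (map snd (acts S')) = {x \<in> snd ` set (acts S). req x \<in> R}"
        using sndA by (auto simp: S'_def)
      then show ?thesis using schedule_actions[OF S] \<open>R \<subseteq> Q\<close> by auto
    qed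
    show "case y of (s, x) \<Rightarrow> t \<le> s \<and> pos S' s = place \<sigma> x" if "y \<in> set (acts S')" for y
    proof -
      obtain s x where y: "y = (s, x)" by (cases y)
      then have "(s, x) \<in> set A" using that by (simp add: S'_def)
      then show ?thesis
        using y time[of s x] tm pos_ge[of s] inA[of s x] schedule_action(2)[OF S, of "s - d" x]
        by auto
    qed
    show "rel (\<sigma> ! i) \<le> s" if "(s, Pickup i) \<in> set (acts S')" for s i
    proof -
      have "(s, Pickup i) \<in> set A" using that by (simp add: S'_def)
      then show ?thesis using time[of s "Pickup i"] tm inA[of s "Pickup i"] released[of i] by auto
    qed
    show "\<exists>xs ys zs. map snd (acts S') = xs @ Pickup i # ys @ Deliver i # zs" if "i \<in> R" for i
    proof -
      have "i \<in> Q" using that \<open>R \<subseteq> Q\<close> by blast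
      then obtain xs ys zs where "map snd (acts S) = xs @ Pickup i # ys @ Deliver i # zs"
        using order by blast
      then show ?thesis using that by (auto simp: S'_def sndA)
    qed
    show "enat (card (on_board (take k (acts S')))) \<le> c" if "k \<le> length (acts S')" for k
    proof -
      obtain k' where k': "k' \<le> length (acts S)"
        "take k (filter P (acts S)) = filter P (take k' (acts S))"
        using take_filter by blast
      have "map snd (take k A) = map snd (filter P (take k' (acts S)))"
        unfolding k'(2)[symmetric] A_def by (simp add: take_map comp_def case_prod_beta)
      then have "on_board (take k A) = on_board (take k' (acts S)) \<inter> R"
        using on_board_cong on_board_filter unfolding P_def by metis
      then have "card (on_board (take k A)) \<le> card (on_board (take k' (acts S)))"
        by (simp add: card_mono finite_on_board)
      then show ?thesis using cap[OF k'(1)] by (simp add: S'_def) (meson enat_ord_simps(1) order_trans)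
    qed
  qed
  obtain x where "(t + sched_length t S', x) \<in> set (acts S')"
    using schedule_last[OF schedule \<open>R \<noteq> {}\<close>] by blast
  then have "t + sched_length t S' \<le> z + d"
    using time by (simp add: S'_def)
  then show ?thesis
    using L_le_sched_length[OF schedule] by (simp add: d_def m_def a_def)
qed

section \<open>Existence of a schedule for all requests\<close>

lemma lipschitz_interpolation:
  fixes w \<tau> :: "'a \<Rightarrow> real"
  assumes I: "finite I" "I \<noteq> {}"
    and data: "\<And>i j. i \<in> I \<Longrightarrow> j \<in> I \<Longrightarrow> \<bar>w i - w j\<bar> \<le> \<bar>\<tau> i - \<tau> j\<bar>"
  obtains f where "1-lipschitz_on UNIV f" "\<And>i. i \<in> I \<Longrightarrow> f (\<tau> i) = w i"
proof -
  \<comment> \<open>McShane's extension, a minimum of cones of slope 1. At \<open>\<tau> i\<close>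
    the cone of \<open>i\<close> has value \<open>w i\<close>, and \<open>data\<close> keeps every
    other cone from being lower.\<close>
  define f where "f s = Min ((\<lambda>i. w i + \<bar>s - \<tau> i\<bar>) ` I)" for s
  have le: "f s \<le> w i + \<bar>s - \<tau> i\<bar>" if "i \<in> I" for s i
    unfolding f_def using I that by (intro Min_le) auto
  have ex: "\<exists>i\<in>I. f s = w i + \<bar>s - \<tau> i\<bar>" for s
  proof -
    have "f s \<in> (\<lambda>i. w i + \<bar>s - \<tau> i\<bar>) ` I" unfolding f_def using I by (intro Min_in) auto
    then show ?thesis by auto
  qed
  have half: "f x \<le> f y + \<bar>x - y\<bar>" for x y
  proof -
    obtain i where "i \<in> I" "f y = w i + \<bar>y - \<tau> i\<bar>" using ex by blast
    then show ?thesis using le[of i x] by linarith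
  qed
  have "1-lipschitz_on UNIV f"
  proof (rule lipschitz_onI)
    fix x y
    show "dist (f x) (f y) \<le> 1 * dist x y"
      using half[of x y] half[of y x] by (simp add: dist_real_def abs_le_iff abs_minus_commute)
  qed simp
  moreover have "f (\<tau> i) = w i" if i: "i \<in> I" for i
  proof -
    obtain j where "j \<in> I" "f (\<tau> i) = w j + \<bar>\<tau> i - \<tau> j\<bar>" using ex by blast
    then show ?thesis using le[OF i, of "\<tau> i"] data[OF i, of j] by linarith
  qed
  ultimately show thesis by (rule that)
qed

text \<open>The requests are served one after another, with the actions so far apart in time that the
  path through their places can be interpolated.\<close>

lemma schedule_exists:
  assumes "c \<ge> 1"
  obtains S where "is_schedule c \<sigma> t p {..<length \<sigma>} S"
proof -
  define n where "n = length \<sigma>"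
  \<comment> \<open>Action number \<open>2 * i\<close> picks up request \<open>i\<close> and the
    next one delivers it; \<open>enc\<close> is the inverse numbering.\<close>
  define ev where "ev m = (if even m then Pickup (m div 2) else Deliver (m div 2))" for m :: nat
  define enc where "enc x = (case x of Pickup i \<Rightarrow> 2 * i | Deliver i \<Rightarrow> 2 * i + 1)" for x
  have enc_ev: "enc (ev m) = m" for m by (auto simp: enc_def ev_def)
  have ev_enc: "ev (enc x) = x" for x by (cases x) (auto simp: enc_def ev_def)
  have ev_iff: "x \<in> ev ` {..<k} \<longleftrightarrow> enc x < k" for x k
    using enc_ev ev_enc by (metis image_iff lessThan_iff)
  have enc_req: "enc x < 2 * n \<longleftrightarrow> req x < n" for x by (cases x) (auto simp: enc_def)
  \<comment> \<open>Index 0 is reserved for the starting position, so action \<open>m\<close> takes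
    place at time \<open>\<tau> (Suc m)\<close>.\<close>
  define w where "w m = (if m = 0 then p else place \<sigma> (ev (m - 1)))" for m
  \<comment> \<open>One step of length \<open>B\<close> bridges any two of the places, and already
    the first action, at time \<open>t + B\<close>, comes after all releases.\<close>
  define B where "B = 1 + 2 * (\<Sum>m\<le>2 * n. \<bar>w m\<bar>) + \<bar>t\<bar> + (\<Sum>i<n. \<bar>rel (\<sigma> ! i)\<bar>)"
  have nonneg: "0 \<le> (\<Sum>m\<le>2 * n. \<bar>w m\<bar>)" "0 \<le> (\<Sum>i<n. \<bar>rel (\<sigma> ! i)\<bar>)"
    by (auto intro: sum_nonneg)
  have "B > 0" using nonneg unfolding B_def by linarith
  have B_w: "2 * \<bar>w m\<bar> \<le> B" if "m \<le> 2 * n" for m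
  proof -
    have "\<bar>w m\<bar> \<le> (\<Sum>m\<le>2 * n. \<bar>w m\<bar>)"
      using that by (intro member_le_sum) auto
    then show ?thesis using nonneg unfolding B_def by linarith
  qed
  have B_rel: "rel (\<sigma> ! i) \<le> t + B" if "i < n" for i
  proof -
    have "\<bar>rel (\<sigma> ! i)\<bar> \<le> (\<Sum>i<n. \<bar>rel (\<sigma> ! i)\<bar>)"
      using that by (intro member_le_sum) auto
    then show ?thesis using nonneg unfolding B_def by linarith
  qed
  define \<tau> where "\<tau> m = t + B * real m" for m
  have data: "\<bar>w i - w j\<bar> \<le> \<bar>\<tau> i - \<tau> j\<bar>" if "i \<in> {..2 * n}" "j \<in> {..2 * n}" for i j
  proof (cases "i = j")
    case False
    then have "1 \<le> \<bar>real i - real j\<bar>" by linarith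
    then have "B * 1 \<le> B * \<bar>real i - real j\<bar>" using \<open>B > 0\<close> by (intro mult_left_mono) auto
    also have "\<dots> = \<bar>B * (real i - real j)\<bar>" using \<open>B > 0\<close> by (simp add: abs_mult)
    also have "\<dots> = \<bar>\<tau> i - \<tau> j\<bar>" by (simp add: \<tau>_def right_diff_distrib)
    finally show ?thesis using B_w[of i] B_w[of j] that by auto
  qed simp
  obtain f where f: "1-lipschitz_on UNIV f" "\<And>m. m \<in> {..2 * n} \<Longrightarrow> f (\<tau> m) = w m"
    using lipschitz_interpolation[of "{..2 * n}" w \<tau>] data by auto
  define S where "S = \<lparr>pos = f, acts = map (\<lambda>m. (\<tau> (Suc m), ev m)) [0..<2 * n]\<rparr>"
  have map_snd: "map snd (acts S) = map ev [0..<2 * n]"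
    by (simp add: S_def)
  have late: "t + B \<le> \<tau> (Suc m)" for m
    using \<open>B > 0\<close> by (simp add: \<tau>_def algebra_simps)
  have "is_schedule c \<sigma> t p {..<length \<sigma>} S"
    unfolding is_schedule_def actions_eq
  proof (intro conjI ballI allI impI)
    show "1-lipschitz_on {t..} (pos S)"
      using lipschitz_on_subset[OF f(1)] by (simp add: S_def)
    show "pos S t = p" using f(2)[of 0] by (simp add: S_def \<tau>_def w_def)
    have "\<tau> (Suc a) \<le> \<tau> (Suc b)" if "a \<le> b" for a b
      using that \<open>B > 0\<close> by (simp add: \<tau>_def)
    then show "sorted (map fst (acts S))"
      by (auto simp: S_def comp_def sorted_iff_nth_mono)
    show "case y of (s, x) \<Rightarrow> t \<le> s \<and> pos S s = place \<sigma> x" if "y \<in> set (acts S)" for y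
    proof -
      from that obtain m where m: "m < 2 * n" "y = (\<tau> (Suc m), ev m)" by (auto simp: S_def)
      then show ?thesis using late[of m] \<open>B > 0\<close> f(2)[of "Suc m"] by (simp add: S_def w_def)
    qed
    show "rel (\<sigma> ! i) \<le> s" if "(s, Pickup i) \<in> set (acts S)" for s i
    proof -
      from that obtain m where m: "m < 2 * n" "s = \<tau> (Suc m)" "Pickup i = ev m"
        by (auto simp: S_def)
      then have "i < n" using enc_req[of "Pickup i"] enc_ev[of m] by (metis req.simps(1))
      then show ?thesis using B_rel[of i] late[of m] m(2) by simp
    qed
    show "distinct (map snd (acts S))"
      unfolding map_snd distinct_map using enc_ev by (metis distinct_upt inj_on_inverseI)
    have "snd ` set (acts S) = ev ` {..<2 * n}"
      using arg_cong[OF map_snd, of set] by (simp add: atLeast0LessThan)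
    then show "snd ` set (acts S) = {x. req x \<in> {..<length \<sigma>}}"
      using ev_iff enc_req by (auto simp: n_def)
    show "\<exists>j k. j < k \<and> k < length (acts S) \<and> snd (acts S ! j) = Pickup i \<and>
      snd (acts S ! k) = Deliver i" if "i \<in> {..<length \<sigma>}" for i
      using that by (intro exI[of _ "2 * i"] exI[of _ "2 * i + 1"]) (auto simp: S_def n_def ev_def)
    show "enat (card (on_board (take k (acts S)))) \<le> c" if "k \<le> length (acts S)" for k
    proof -
      have "map snd (take k (acts S)) = map ev [0..<k]"
        using that by (simp add: S_def take_map comp_def)
      then have snd_eq: "snd ` set (take k (acts S)) = ev ` {..<k}"
        by (metis atLeast0LessThan atLeastLessThan_upt list.set_map)
      \<comment> \<open>After \<open>k\<close> actions only the request whose pickup was the last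
        action can be on board, so capacity 1 suffices.\<close>
      have "i = k div 2" if "i \<in> on_board (take k (acts S))" for i
      proof -
        have "2 * i < k" "\<not> 2 * i + 1 < k"
          using that ev_iff[of "Pickup i" k] ev_iff[of "Deliver i" k]
          unfolding on_board_def snd_eq by (simp_all add: enc_def)
        then show ?thesis by linarith
      qed
      then have "on_board (take k (acts S)) \<subseteq> {k div 2}" by blast
      then have "card (on_board (take k (acts S))) \<le> 1"
        using card_mono[of "{k div 2}"] by simp
      then have "enat (card (on_board (take k (acts S)))) \<le> 1" by (simp add: one_enat_def)
      then show ?thesis using assms by (rule order_trans)
    qed
  qed
  then show thesis by (rule that)
qed

subsection \<open>The competitive ratio\<close>

text \<open>If the offline server visits the start of the last schedule after time
  \<open>\<tau>\<close>, the cost is at most \<open>\<Theta>\<close> per unit of time before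
  \<open>\<tau>\<close> and 2 per unit afterwards. Both rates are covered by
  \<open>f2 \<Theta>\<close>.\<close>

lemma f2_ge:
  assumes "\<Theta> > 1"
  shows "\<Theta> \<le> f2 \<Theta>" "2 \<le> f2 \<Theta>"
proof -
  have "(\<Theta> - 1) / (3 * \<Theta> + 3) \<le> 1" using assms by simp
  then show "\<Theta> \<le> f2 \<Theta>" by (simp add: f2_def)
  have "(\<Theta> - 1) / (3 * \<Theta> + 3) \<le> (\<Theta> - 1) / 1"
    using assms by (intro divide_left_mono) auto
  then show "2 \<le> f2 \<Theta>" by (simp add: f2_def)
qed

text \<open>The claim is the average of the upper bounds \<open>(\<Theta> + 1) T - \<Theta> (T - \<tau>) - g\<close> and
  \<open>2 T + 3 (T - \<tau>) + (3 \<Theta> + 2) g\<close>, with weights \<open>3 \<Theta> + 2\<close> and \<open>1\<close>,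
  where \<open>g = \<tau> - \<bar>a - e\<bar>\<close>.\<close>

lemma ratio_arithmetic:
  fixes \<Theta> u v \<tau> T D s e a q te T' :: real
  assumes \<Theta>: "\<Theta> > 1"
    and "u \<le> \<tau>" "\<tau> \<le> T" "D \<le> (\<Theta> - 1) * u" "\<bar>s\<bar> \<le> \<Theta> * v" "v \<le> te" "\<bar>e\<bar> \<le> te"
    and te: "te + \<bar>a - e\<bar> \<le> \<tau>"
    and D: "D \<le> \<bar>s\<bar> + T'" "\<bar>q - s\<bar> + \<bar>q - e\<bar> \<le> D"
    and T': "T' \<le> T" "T' + \<bar>a - q\<bar> \<le> \<tau> \<or> \<tau> + \<bar>a - q\<bar> \<le> T'"
  shows "u + D + (\<bar>a - e\<bar> + (T - \<tau>)) \<le> f2 \<Theta> * T"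
proof -
  define g where "g = \<tau> - \<bar>a - e\<bar>"
  define w where "w = T - \<tau>"
  define X where "X = u + D + (\<bar>a - e\<bar> + (T - \<tau>))"
  have w: "0 \<le> w" using assms by (simp add: w_def)
  have "\<Theta> * v \<le> \<Theta> * g" using assms by (intro mult_left_mono) (auto simp: g_def)
  then have s: "\<bar>s\<bar> \<le> \<Theta> * g" using assms by linarith
  have e: "\<bar>e\<bar> \<le> g" using assms by (simp add: g_def)
  \<comment> \<open>In both cases of the disjunction, |q - e| >= T' - g - 2 w. Since |q - s| >= |q -
    e| - |s| - |e|, the detour gives D >= 2 (T' - g - 2 w) - |s| - |e|, and inserting T' >= D - |s|
    yields an upper bound on \<open>D\<close>.\<close>
  have "D \<le> 3 * \<bar>s\<bar> + 4 * w + 2 * g + \<bar>e\<bar>"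
    using D T' w unfolding g_def w_def by argo
  then have B1: "X \<le> 2 * T + 3 * w + (3 * (\<Theta> * g) + 2 * g)"
    using s e \<open>u \<le> \<tau>\<close> unfolding X_def g_def w_def by argo
  have "\<Theta> * u \<le> \<Theta> * \<tau>" using assms by (intro mult_left_mono) auto
  then have B2: "X \<le> (\<Theta> + 1) * T - \<Theta> * w - g"
    using \<open>D \<le> (\<Theta> - 1) * u\<close> unfolding X_def g_def w_def by (simp add: algebra_simps)
  \<comment> \<open>With this weight the terms in \<open>g\<close> cancel once \<open>B1\<close> is
    added.\<close>
  have "(3 * \<Theta> + 2) * X \<le> (3 * \<Theta> + 2) * ((\<Theta> + 1) * T - \<Theta> * w - g)"
    using B2 \<Theta> by (intro mult_left_mono) auto
  then have "(3 * \<Theta> + 3) * X \<le>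
      ((3 * \<Theta> + 2) * (\<Theta> + 1) + 2) * T - (\<Theta> * (3 * \<Theta> + 2) - 3) * w"
    using B1 by (simp add: algebra_simps)
  also have "\<dots> \<le> ((3 * \<Theta> + 2) * (\<Theta> + 1) + 2) * T"
  proof -
    have "1 * 5 \<le> \<Theta> * (3 * \<Theta> + 2)" using \<Theta> by (intro mult_mono) auto
    then show ?thesis using w by simp
  qed
  also have "\<dots> = (3 * \<Theta> + 3) * (f2 \<Theta> * T)"
    using \<Theta> by (simp add: f2_def field_simps)
  finally show ?thesis using \<Theta> by (simp add: X_def)
qed

section \<open>Invariants of a run\<close>

locale run =
  fixes c :: enat and \<Theta> :: real and \<sigma> :: inst
    and N :: nat and t p :: "nat \<Rightarrow> real" and S :: "nat \<Rightarrow> schedule"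
  assumes \<Theta>: "\<Theta> > 1" and run: "smartstart_run c \<Theta> \<sigma> N t p S"
begin

abbreviation U :: "nat \<Rightarrow> nat set" where "U j \<equiv> unserved \<sigma> S j (t j)"
abbreviation D :: "nat \<Rightarrow> real" where "D j \<equiv> L c \<sigma> (t j) (p j) (U j)"
abbreviation F :: "nat \<Rightarrow> real" where "F j \<equiv> finish_time c \<sigma> t p S j"

lemma F_eq: "1 \<le> j \<Longrightarrow> F j = t j + D j"
  by (simp add: finish_time_def)

lemma U_subset: "U j \<subseteq> {..<length \<sigma>}"
  by (auto simp: unserved_def)

lemma U_released: "i \<in> U j \<Longrightarrow> rel (\<sigma> ! i) \<le> t j"
  by (simp add: unserved_def)

context
  fixes j assumes j: "1 \<le> j" "j \<le> N"
begin

lemma step: "t j \<in> start_times c \<Theta> \<sigma> S j (F (j - 1)) (p j)"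
    "is_shortest c \<sigma> (t j) (p j) (U j) (S j)" "p (j + 1) = end_pos \<sigma> (S j)"
  using run j unfolding smartstart_run_def by auto

lemma schedule: "is_schedule c \<sigma> (t j) (p j) (U j) (S j)"
  using step(2) by (simp add: is_shortest_def)

lemma D_eq: "D j = sched_length (t j) (S j)"
  by (rule L_eq_sched_length[OF step(2)])

lemma D_nonneg: "0 \<le> D j"
  using schedule_length_nonneg[OF schedule] D_eq by simp

lemma start: "F (j - 1) \<le> t j" "U j \<noteq> {}" "D j \<le> (\<Theta> - 1) * t j"
  using step(1) \<Theta> unfolding start_times_def by (auto simp: field_simps)

lemma F_le: "F j \<le> \<Theta> * t j"
  using start(3) F_eq[OF j(1)] by (simp add: algebra_simps)

lemma last_action:
  obtains x where "req x \<in> U j" "place \<sigma> x = p (j + 1)" "pos (S j) (F j) = p (j + 1)"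
proof -
  obtain x where x: "(F j, x) \<in> set (acts (S j))" "p (j + 1) = place \<sigma> x"
    using schedule_last[OF schedule start(2)] step(3) D_eq F_eq[OF j(1)] by metis
  then show thesis using that[of x] schedule_action[OF schedule x(1)] by simp
qed

text \<open>The speed bound is applied separately before and after the action \<open>x\<close>; at
  time \<open>F j\<close> the server has arrived at \<open>p (j + 1)\<close>.\<close>

lemma detour_le:
  assumes "req x \<in> U j"
  shows "\<bar>place \<sigma> x - p j\<bar> + \<bar>place \<sigma> x - p (j + 1)\<bar> \<le> D j"
proof -
  have y: "pos (S j) (F j) = p (j + 1)" using last_action by metis
  obtain s where s: "(s, x) \<in> set (acts (S j))" using schedule_time[OF schedule assms] by blast
  note sx = schedule_action[OF schedule s] schedule_start[OF schedule]
  have sF: "s \<le> F j" using schedule_le_length[OF schedule s] D_eq F_eq[OF j(1)] by simp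
  have "\<bar>place \<sigma> x - p j\<bar> \<le> s - t j"
    using schedule_speed[OF schedule, of s "t j"] sx by simp
  moreover have "\<bar>place \<sigma> x - p (j + 1)\<bar> \<le> F j - s"
    using schedule_speed[OF schedule, of s "F j"] sx y sF by simp
  ultimately show ?thesis using F_eq[OF j(1)] by simp
qed

lemma move_le: "\<bar>p (j + 1) - p j\<bar> \<le> D j"
proof -
  obtain x where "req x \<in> U j" "place \<sigma> x = p (j + 1)" using last_action by metis
  then show ?thesis using detour_le[of x] by simp
qed

end

text \<open>The displacement in each schedule is at most its length, and these lengths add up to at
  most the elapsed time.\<close>

lemma p_le:
  assumes "1 \<le> j" "j \<le> N"
  shows "\<bar>p j\<bar> \<le> F (j - 1)"
  using assms
proof (induction j rule: dec_induct)
  case base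
  then show ?case using run by (simp add: smartstart_run_def finish_time_def)
next
  case (step n)
  then show ?case using move_le[of n] start(1)[of n] F_eq[of n] by simp
qed

text \<open>A request released by \<open>t j\<close> and still open at \<open>t (Suc j)\<close>
  would belong to \<open>U j\<close>. Then \<open>S j\<close> delivers it by \<open>F j\<close>,
  which is at most \<open>t (Suc j)\<close>, a contradiction.\<close>

lemma U_later:
  assumes "1 \<le> j" "Suc j \<le> N" "i \<in> U (Suc j)"
  shows "t j < rel (\<sigma> ! i)"
proof (rule ccontr)
  assume "\<not> t j < rel (\<sigma> ! i)"
  then have released: "rel (\<sigma> ! i) \<le> t j" by simp
  have j: "1 \<le> j" "j \<le> N" using assms by auto
  have F: "F j \<le> t (Suc j)" using start(1)[of "Suc j"] assms by simp
  have le: "t j \<le> t (Suc j)" using F F_eq[OF j(1)] D_nonneg[OF j] by simp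
  have i: "i < length \<sigma>"
    and undelivered: "\<And>k s. k \<in> {1..<Suc j} \<Longrightarrow> s \<le> t (Suc j) \<Longrightarrow> (s, Deliver i) \<notin> set (acts (S k))"
    using assms(3) unfolding unserved_def by auto
  have "i \<in> U j"
    unfolding unserved_def
  proof (intro CollectI conjI notI i released)
    assume "\<exists>k\<in>{1..<j}. \<exists>s\<le>t j. (s, Deliver i) \<in> set (acts (S k))"
    then obtain k s where "k \<in> {1..<j}" "s \<le> t j" "(s, Deliver i) \<in> set (acts (S k))" by blast
    then show False using undelivered[of k s] le by auto
  qed
  then obtain s where s: "(s, Deliver i) \<in> set (acts (S j))"
    using schedule_time[OF schedule[OF j], of "Deliver i"] by auto
  then have "s \<le> F j" using schedule_le_length[OF schedule[OF j] s] D_eq[OF j] F_eq[OF j(1)] by simp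
  then show False using undelivered[of j s] s F j by auto
qed

section \<open>Runs with at least two schedules against an arbitrary offline schedule\<close>

lemma F_N_le:
  assumes "valid_instance \<sigma>" and no_wait: "t N = F (N - 1)" and "2 \<le> N"
    and Q: "is_schedule c \<sigma> 0 0 {..<length \<sigma>} Q"
  shows "F N \<le> f2 \<Theta> * sched_length 0 Q"
proof -
  define T where "T = sched_length 0 Q"
  define M where "M = N - 1"
  have N: "N = Suc M" "1 \<le> M" using assms by (auto simp: M_def)
  have jM: "1 \<le> M" "M \<le> N" and jN: "1 \<le> N" "N \<le> N" using N by auto
  \<comment> \<open>\<open>v\<close> stands for the start of the schedule before \<open>S M\<close>.
    For \<open>M = 1\<close> there is none, and 0 works in both roles of \<open>v\<close>: the
    server is at the origin, and releases are nonnegative.\<close>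
  define v where "v = (if M = 1 then 0 else t (M - 1))"
  have s: "\<bar>p M\<bar> \<le> \<Theta> * v"
  proof (cases "M = 1")
    case True
    then show ?thesis using p_le[OF jM] by (simp add: v_def finish_time_def)
  next
    case False
    then have "F (M - 1) \<le> \<Theta> * v" using F_le[of "M - 1"] jM by (simp add: v_def)
    then show ?thesis using p_le[OF jM] by simp
  qed
  have v: "v \<le> rel (\<sigma> ! i)" if "i \<in> U M" for i
  proof (cases "M = 1")
    case True
    have "i < length \<sigma>" using that U_subset by blast
    then show ?thesis using assms(1) True by (simp add: v_def valid_instance_def)
  next
    case False
    then have "1 \<le> M - 1" "Suc (M - 1) = M" using jM by auto
    then have "t (M - 1) < rel (\<sigma> ! i)" using U_later[of "M - 1" i] that jM by simp
    then show ?thesis using False by (simp add: v_def)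
  qed
  have before_T: "s \<le> T" if "(s, x) \<in> set (acts Q)" for s x
    using schedule_le_length[OF Q that] by (simp add: T_def)
  obtain \<tau> x where \<tau>: "(\<tau>, x) \<in> set (acts Q)" "req x \<in> U N"
    and first: "\<And>s y. (s, y) \<in> set (acts Q) \<Longrightarrow> req y \<in> U N \<Longrightarrow> \<tau> \<le> s"
    using schedule_first_action[OF Q U_subset start(2)[OF jN]] by blast
  obtain T' y where T': "(T', y) \<in> set (acts Q)" "req y \<in> U M"
    and last: "\<And>s y. (s, y) \<in> set (acts Q) \<Longrightarrow> req y \<in> U M \<Longrightarrow> s \<le> T'"
    using schedule_last_action[OF Q U_subset start(2)[OF jM]] by blast
  \<comment> \<open>The final action of \<open>S M\<close> takes place at \<open>p N\<close>.
    \<open>Q\<close> executes the same action at time \<open>te\<close>, which yields a visit of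
    \<open>Q\<close> to \<open>p N\<close> after the release of a request of
    \<open>U M\<close>.\<close>
  obtain z where z: "req z \<in> U M" "place \<sigma> z = p N"
    using last_action[OF jM] N by (metis Suc_eq_plus1)
  obtain te where te: "(te, z) \<in> set (acts Q)"
    using schedule_time[OF Q, of z] z(1) U_subset by blast
  define a where "a = place \<sigma> x"
  define q where "q = place \<sigma> y"
  note Q\<tau> = schedule_action[OF Q \<tau>(1)] schedule_after_release[OF Q \<tau>(1)]
    and QT' = schedule_action[OF Q T'(1)]
    and Qte = schedule_action[OF Q te] schedule_after_release[OF Q te]
  have u: "t M < \<tau>" using U_later[of M "req x"] \<tau>(2) N Q\<tau> by simp
  have DN: "D N \<le> \<bar>a - p N\<bar> + (T - \<tau>)"
    using L_le_replay[OF Q U_subset start(2)[OF jN] Q\<tau>(1), of "t N" T "p N"]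
      U_released first before_T Q\<tau>(2) by (simp add: a_def abs_minus_commute)
  \<comment> \<open>The replay window starts at time 0, so the preliminary walk leads back to the
    origin.\<close>
  have DM: "D M \<le> \<bar>p M\<bar> + T'"
    using L_le_replay[OF Q U_subset start(2)[OF jM] order_refl, of "t M" T' "p M"]
      U_released last schedule_action(1)[OF Q] schedule_start[OF Q] by simp
  have FN: "F N = t M + D M + D N"
    using no_wait F_eq[OF jN(1)] F_eq[OF jM(1)] N by simp
  show ?thesis
  proof (cases "te \<le> \<tau>")
    case True
    have "te + \<bar>a - p N\<bar> \<le> \<tau>"
      using schedule_speed[OF Q, of \<tau> te] Q\<tau> Qte True z(2) by (simp add: a_def)
    moreover have "\<bar>p N\<bar> \<le> te"
      using schedule_speed[OF Q, of te 0] Qte schedule_start[OF Q] z(2) by simp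
    moreover have "v \<le> te" using v[OF z(1)] Qte by simp
    \<comment> \<open>The last action of \<open>Q\<close> for \<open>U M\<close> may precede or
      follow its first action for \<open>U N\<close>.\<close>
    moreover have "T' + \<bar>a - q\<bar> \<le> \<tau> \<or> \<tau> + \<bar>a - q\<bar> \<le> T'"
      using schedule_speed[OF Q, of \<tau> T'] Q\<tau> QT' by (auto simp: a_def q_def)
    moreover have "\<bar>q - p M\<bar> + \<bar>q - p N\<bar> \<le> D M"
      using detour_le[OF jM T'(2)] N by (simp add: q_def)
    ultimately have "t M + D M + (\<bar>a - p N\<bar> + (T - \<tau>)) \<le> f2 \<Theta> * T"
      using ratio_arithmetic[OF \<Theta>, of "t M" \<tau> T "D M" "p M" v te "p N" a T' q] u s DM
        start(3)[OF jM] before_T \<tau>(1) T'(1) by auto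
    then show ?thesis using DN FN by (simp add: T_def)
  next
    case False
    have "\<bar>a - p N\<bar> \<le> te - \<tau>"
      using schedule_speed[OF Q, of \<tau> te] Q\<tau> Qte False z(2) by (simp add: a_def)
    then have "\<bar>a - p N\<bar> \<le> T - \<tau>" using before_T[OF te] by simp
    then have *: "F N \<le> \<Theta> * t M + 2 * (T - \<tau>)"
      using FN DN start(3)[OF jM] by (simp add: algebra_simps)
    have "\<Theta> * t M \<le> \<Theta> * \<tau>" "0 \<le> T - \<tau>" "0 \<le> \<tau>"
      using u \<Theta> before_T[OF \<tau>(1)] Q\<tau> by auto
    moreover have "\<Theta> * \<tau> \<le> f2 \<Theta> * \<tau>" "2 * (T - \<tau>) \<le> f2 \<Theta> * (T - \<tau>)"
      using calculation f2_ge[OF \<Theta>] by (intro mult_right_mono; simp)+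
    ultimately have "F N \<le> f2 \<Theta> * \<tau> + f2 \<Theta> * (T - \<tau>)" using * by linarith
    then show ?thesis by (simp add: T_def algebra_simps)
  qed
qed

end

theorem proposition3p7:
  fixes c :: enat and \<Theta> :: real and \<sigma> :: inst
    and N :: nat and t p :: "nat \<Rightarrow> real" and S :: "nat \<Rightarrow> schedule"
  assumes "c \<ge> 1"
    and "\<Theta> > 1"
    and "valid_instance \<sigma>"
    and "smartstart_run c \<Theta> \<sigma> N t p S"
    and no_wait: "t N = finish_time c \<sigma> t p S (N - 1)"
  shows "finish_time c \<sigma> t p S N \<le> f2 \<Theta> * Opt c \<sigma>"
proof -
  interpret run c \<Theta> \<sigma> N t p S
    using assms by unfold_locales
  have f2: "f2 \<Theta> > 0" using f2_ge[OF \<Theta>] by simp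
  have bound: "F N \<le> f2 \<Theta> * sched_length 0 Q"
    if Q: "is_schedule c \<sigma> 0 0 {..<length \<sigma>} Q" for Q
  proof (cases "2 \<le> N")
    case True
    then show ?thesis using F_N_le assms(3) no_wait Q by blast
  next
    case False
    have "N \<noteq> 0"
      using run \<open>valid_instance \<sigma>\<close> by (auto simp: smartstart_run_def valid_instance_def)
    then have N: "N = 1" using False by simp
    \<comment> \<open>A start at time 0 is allowed only for a schedule of length 0.\<close>
    then have "t N = 0" using no_wait by (simp add: finish_time_def)
    then have "F N \<le> 0" using F_le[of N] N by simp
    also have "0 \<le> f2 \<Theta> * sched_length 0 Q"
      using f2 schedule_length_nonneg[OF Q] by simp
    finally show ?thesis .
  qed
  \<comment> \<open>The value of an infimum over the empty set would be unspecified. As the set is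
    nonempty, \<open>bound\<close>, which holds for every \<open>Q\<close>, passes to the
    infimum.\<close>
  obtain Q0 where "is_schedule c \<sigma> 0 0 {..<length \<sigma>} Q0"
    using schedule_exists[OF \<open>c \<ge> 1\<close>] by blast
  then have "F N / f2 \<Theta> \<le> Opt c \<sigma>"
    unfolding Opt_def L_def
    by (intro cINF_greatest) (use bound f2 in \<open>auto simp: field_simps\<close>)
  then show ?thesis using f2 by (simp add: field_simps)
qed

end
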